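(* Let $n\ge 1$ and let $I=\{1,i_1,i_2,\ldots,i_{k-1}\}$ be a lucky set of $\mathrm{PF}_n$ with $1<i_1<\cdots<i_{k-1}\le n$ (so $|I|=k$). Let $\mathcal{O}_n(I)=\{\mathcal{O}(\alpha):\alpha\in\mathrm{PF}_n \text{ and } \mathsf{Lucky}(\alpha)=I\}$. Then $$|\mathcal{O}_n(I)|=k!\prod_{j\in[n]\setminus I}|I\cap[j]|=2^{i_2-i_1}\,3^{i_3-i_2}\cdots(k-1)^{i_{k-1}-i_{k-2}}\,k^{\,n-(i_{k-1}-1)},$$ where the last expression means $\Big(\prod_{\ell=2}^{k-1}\ell^{\,i_\ell-i_{\ell-1}}\Big)k^{\,n-(i_{k-1}-1)}$, with $i_0:=1$ in the case $k=1$.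
   Context: Notation: $[n]=\{1,\dots,n\}$. Consider a one-way street with spots $1,\dots,n$ and cars $1,\dots,n$ entering one at a time in this order. Car $i$ has a preferred spot $a_i\in[n]$; it drives to spot $a_i$ and parks there if it is unoccupied; otherwise it continues forward and parks in the first unoccupied spot after $a_i$, if one exists, and fails to park otherwise. The list $\alpha=(a_1,\dots,a_n)\in[n]^n$ is a parking function of length $n$ if all cars can park; $\mathrm{PF}_n$ is the set of these. The outcome of $\alpha\in\mathrm{PF}_n$ is the permutation $\mathcal{O}(\alpha)=\pi_1\pi_2\cdots\pi_n$ of $[n]$ where $\pi_i$ is the car parked in spot $i$. A car $i$ is lucky if it parks in its preferred spot $a_i$, and $\mathsf{Lucky}(\alpha)$ is the set of lucky cars. A set $I\subseteq[n]$ is a lucky set of $\mathrm{PF}_n$ if $I=\mathsf{Lucky}(\alpha)$ for some $\alpha\in\mathrm{PF}_n$. *)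

theory Defs
  imports Main
begin

text \<open>
  A preference list \<open>(a\<^sub>1, \<dots>, a\<^sub>n)\<close> is a \<^typ>\<open>nat list\<close> of length \<open>n\<close>. Spots and cars are numbered
  from 1, whereas list positions start at 0: car \<open>i\<close> prefers spot \<open>\<alpha> ! (i - 1)\<close>.
\<close>

text \<open>The spot taken on a street with \<open>n\<close> spots, those in \<open>occ\<close> being occupied, by a car that
  prefers spot \<open>a\<close>; \<^const>\<open>None\<close> if it fails to park.\<close>

definition chosen_spot :: "nat \<Rightarrow> nat set \<Rightarrow> nat \<Rightarrow> nat option" where
  "chosen_spot n occ a =
     (if a \<notin> occ then Some a
      else if \<exists>s\<in>{a<..n}. s \<notin> occ then Some (LEAST s. a < s \<and> s \<notin> occ)
      else None)"

text \<open>\<open>street \<alpha> m\<close> maps each spot occupied after the arrival of cars \<open>1, \<dots>, m\<close> to the car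
  parked there. A car that fails to park leaves the street unchanged.\<close>

primrec street :: "nat list \<Rightarrow> nat \<Rightarrow> (nat \<rightharpoonup> nat)" where
  "street \<alpha> 0 = Map.empty"
| "street \<alpha> (Suc m) =
     (case chosen_spot (length \<alpha>) (dom (street \<alpha> m)) (\<alpha> ! m) of
        None \<Rightarrow> street \<alpha> m
      | Some s \<Rightarrow> (street \<alpha> m)(s \<mapsto> Suc m))"

definition parking_spot :: "nat list \<Rightarrow> nat \<Rightarrow> nat option" where
  "parking_spot \<alpha> i = chosen_spot (length \<alpha>) (dom (street \<alpha> (i - 1))) (\<alpha> ! (i - 1))"

definition PF :: "nat \<Rightarrow> nat list set" where
  "PF n = {\<alpha>. length \<alpha> = n \<and> set \<alpha> \<subseteq> {1..n} \<and> (\<forall>i\<in>{1..n}. parking_spot \<alpha> i \<noteq> None)}"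

text \<open>The permutation \<open>\<pi>\<^sub>1 \<dots> \<pi>\<^sub>n\<close> in one-line notation. The use of \<^const>\<open>the\<close> is
  unproblematic for parking functions, where all spots end up occupied.\<close>

definition outcome :: "nat list \<Rightarrow> nat list" where
  "outcome \<alpha> = map (\<lambda>s. the (street \<alpha> (length \<alpha>) s)) [1..<Suc (length \<alpha>)]"

definition Lucky :: "nat list \<Rightarrow> nat set" where
  "Lucky \<alpha> = {i \<in> {1..length \<alpha>}. parking_spot \<alpha> i = Some (\<alpha> ! (i - 1))}"

definition lucky_set :: "nat \<Rightarrow> nat set \<Rightarrow> bool" where
  "lucky_set n I \<longleftrightarrow> I \<subseteq> {1..n} \<and> (\<exists>\<alpha>\<in>PF n. I = Lucky \<alpha>)"

definition outcomes :: "nat \<Rightarrow> nat set \<Rightarrow> nat list set" where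
  "outcomes n I = outcome ` {\<alpha> \<in> PF n. Lucky \<alpha> = I}"

end

theory Submission
  imports Defs
begin

text \<open>
  The outcomes with a prescribed lucky set can be recognised locally. If car \<open>j\<close> is unlucky, it
  has driven past occupied spots only, so the spot just before its own holds a car that came
  earlier. Conversely, suppose that in a permutation every car outside \<open>I\<close> stands immediately
  after a car with a smaller number. Let the cars of \<open>I\<close> prefer their own spot and the other
  cars the spot before their own; then every car parks where the permutation puts it, and exactly
  the cars of \<open>I\<close> are lucky. Hence the outcomes are the permutations of \<open>1, \<dots>, n\<close> in which
  each entry outside \<open>I\<close> has a smaller left neighbour (\<open>outcomes_eq_arrangements\<close>); in
  particular the first entry belongs to \<open>I\<close>.

  These permutations are counted by inserting the entries in increasing order
  (\<open>card_arrangements\<close>). A new largest entry \<open>m\<close> spoils its right neighbour unless that belongs to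
  \<open>I\<close>, so it goes either to the end or before an entry of \<open>I\<close>. If \<open>m \<in> I\<close>, all these slots are
  allowed; there is one more than there are entries of \<open>I\<close> so far, namely \<open>card (I \<inter> {1..m})\<close>. If
  \<open>m \<notin> I\<close>, the front, which is one of these slots, is forbidden, and again
  \<open>card (I \<inter> {1..m})\<close> slots remain. The count is therefore the product of \<open>card (I \<inter> {1..j})\<close>
  over all \<open>j \<in> {1..n}\<close>.

  Over \<open>j \<in> I\<close> the factors are \<open>1, 2, \<dots>, k\<close>, which gives the factorial in the first formula. The
  second formula collects equal factors: \<open>card (I \<inter> {1..j}) = l\<close> for
  \<open>i (l - 1) \<le> j < i l\<close>, and \<open>card (I \<inter> {1..j}) = k\<close> from \<open>j = i (k - 1)\<close> onwards.
\<close>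

section \<open>Counting permutations whose entries outside \<open>I\<close> follow smaller ones\<close>

text \<open>The value 0 of \<open>x\<close> stands for a missing left neighbour: it is smaller than every entry, but
  the positivity condition keeps it from counting as a predecessor.\<close>

definition precedes_or_anchored :: "nat set \<Rightarrow> nat \<Rightarrow> nat \<Rightarrow> bool" where
  "precedes_or_anchored I x y \<longleftrightarrow> y \<in> I \<or> 0 < x \<and> x < y"

definition anchored :: "nat set \<Rightarrow> nat list \<Rightarrow> bool" where
  "anchored I xs \<longleftrightarrow> successively (precedes_or_anchored I) (0 # xs)"

definition arrangements :: "nat \<Rightarrow> nat set \<Rightarrow> nat list set" where
  "arrangements n I = {xs. distinct xs \<and> set xs = {1..n} \<and> anchored I xs}"

lemma length_arrangement: "xs \<in> arrangements n I \<Longrightarrow> length xs = n"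
  using distinct_card[of xs] by (auto simp: arrangements_def)

text \<open>The definition is convenient for splitting lists; for parking, where positions are
  spots, the condition is needed index by index.\<close>

lemma anchored_conv_nth:
  "anchored I xs \<longleftrightarrow>
     (\<forall>p<length xs. xs ! p \<in> I \<or> 0 < p \<and> 0 < xs ! (p - 1) \<and> xs ! (p - 1) < xs ! p)"
proof (induction xs rule: rev_induct)
  case Nil
  then show ?case by (simp add: anchored_def)
next
  case (snoc x xs)
  have "anchored I (xs @ [x]) \<longleftrightarrow>
      anchored I xs \<and> precedes_or_anchored I (last (0 # xs)) x"
    using successively_append_iff[of _ "0 # xs" "[x]"] by (simp add: anchored_def)
  then show ?case
    unfolding snoc.IH
    by (auto simp: precedes_or_anchored_def nth_append less_Suc_eq last_conv_nth)
qed

definition insert_at :: "'a \<Rightarrow> 'a list \<times> nat \<Rightarrow> 'a list" where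
  "insert_at x = (\<lambda>(xs, p). take p xs @ x # drop p xs)"

text \<open>A fresh \<open>x\<close> marks the place where it was inserted, so both list and position can be
  recovered.\<close>

lemma inj_on_insert_at:
  "inj_on (insert_at x) {(xs, p). x \<notin> set xs \<and> p \<le> length xs}"
proof (rule inj_onI, clarsimp simp: insert_at_def)
  fix xs ys :: "'a list" and p q
  assume x: "x \<notin> set xs" "x \<notin> set ys" and len: "p \<le> length xs" "q \<le> length ys"
    and eq: "take p xs @ x # drop p xs = take q ys @ x # drop q ys"
  have "x \<notin> set (take p xs)" "x \<notin> set (drop p xs)"
    using x by (auto dest: in_set_takeD in_set_dropD)
  then have "take p xs = take q ys" "drop p xs = drop q ys"
    using eq by (simp_all add: append_Cons_eq_iff)
  then show "xs = ys \<and> p = q"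
    using len by (metis append_take_drop_id length_take min.absorb2)
qed

text \<open>The slots in which a new largest entry \<open>m\<close> may be placed: slot \<open>p\<close> lies directly before
  position \<open>p\<close> of \<open>xs\<close>, and slot \<open>length xs\<close> is the end.\<close>

definition slots :: "nat set \<Rightarrow> nat \<Rightarrow> nat list \<Rightarrow> nat set" where
  "slots I m xs =
     {p. p \<le> length xs \<and> (p < length xs \<longrightarrow> xs ! p \<in> I) \<and> (m \<in> I \<or> 0 < p)}"

text \<open>
  Only the two adjacencies created by \<open>m\<close> matter. As \<open>m\<close> exceeds its right neighbour, that
  neighbour must lie in \<open>I\<close>; as \<open>m\<close> exceeds its left neighbour, \<open>m\<close> itself is fine as soon as there
  is one. Conversely, taking \<open>m\<close> out of an anchored list does no harm, since the entry that gets
  a new left neighbour lies in \<open>I\<close>.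
\<close>

lemma anchored_insert_at:
  assumes "\<forall>x\<in>set xs. 0 < x \<and> x < m" and p: "p \<le> length xs"
  shows "anchored I (insert_at m (xs, p)) \<longleftrightarrow> anchored I xs \<and> p \<in> slots I m xs"
proof -
  define us vs where "us = 0 # take p xs" and "vs = drop p xs"
  let ?R = "precedes_or_anchored I"
  have xs: "0 # xs = us @ vs" and ins: "0 # insert_at m (xs, p) = us @ m # vs"
    by (simp_all add: us_def vs_def insert_at_def)
  have "us \<noteq> []" by (simp add: us_def)
  have mem: "x \<in> set xs" if "x \<in> set vs" for x
    using that by (auto simp: vs_def dest: in_set_dropD)
  have hd: "?R m (hd vs) \<longleftrightarrow> hd vs \<in> I" if "vs \<noteq> []"
    using assms(1) mem[of "hd vs"] that by (auto simp: precedes_or_anchored_def)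
  have last: "?R (last us) m \<longleftrightarrow> m \<in> I \<or> 0 < p"
  proof (cases "take p xs = []")
    case True
    then show ?thesis using p by (auto simp: us_def precedes_or_anchored_def)
  next
    case False
    then have "last (take p xs) \<in> set xs"
      by (meson in_set_takeD last_in_set)
    then show ?thesis
      using False assms(1) by (auto simp: us_def precedes_or_anchored_def)
  qed
  have slot: "p \<in> slots I m xs \<longleftrightarrow> (vs \<noteq> [] \<longrightarrow> hd vs \<in> I) \<and> (m \<in> I \<or> 0 < p)"
    using p by (auto simp: slots_def vs_def hd_drop_conv_nth)
  have anchor: "?R x y" if "y \<in> I" for x y
    using that by (simp add: precedes_or_anchored_def)
  show ?thesis
    unfolding anchored_def xs ins slot successively_append_iff successively_Cons
    using \<open>us \<noteq> []\<close> hd last anchor by auto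
qed

text \<open>For \<open>m = Suc n\<close> outside \<open>I\<close> the count relies on position 0 being otherwise eligible, which
  holds because the first entry of an anchored list lies in \<open>I\<close>. The hypothesis \<open>1 \<in> I\<close> ensures
  that \<open>xs\<close> has a first entry in that case.\<close>

lemma card_slots:
  assumes xs: "xs \<in> arrangements n I" and "1 \<in> I"
  shows "card (slots I (Suc n) xs) = card (I \<inter> {1..Suc n})"
proof -
  have len: "length xs = n" and dist: "distinct xs" and set: "set xs = {1..n}"
    and anch: "anchored I xs"
    using xs length_arrangement by (auto simp: arrangements_def)
  define A where "A = {p. p < n \<and> xs ! p \<in> I}"
  have "bij_betw ((!) xs) {..<n} {1..n}"
    using bij_betw_nth[OF dist] len set by simp
  then have inj: "inj_on ((!) xs) {..<n}" and img: "(!) xs ` {..<n} = {1..n}"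
    by (auto simp: bij_betw_def)
  have "inj_on ((!) xs) A"
    by (rule inj_on_subset[OF inj]) (auto simp: A_def)
  moreover have "(!) xs ` A = I \<inter> {1..n}"
    unfolding img[symmetric] A_def by auto
  ultimately have cardA: "card A = card (I \<inter> {1..n})"
    by (metis card_image)
  have finA: "finite A" and "n \<notin> A" by (auto simp: A_def)
  show ?thesis
  proof (cases "Suc n \<in> I")
    case True
    then have "slots I (Suc n) xs = insert n A"
      by (auto simp: slots_def A_def len)
    moreover have "I \<inter> {1..Suc n} = insert (Suc n) (I \<inter> {1..n})"
      using True by auto
    ultimately show ?thesis
      using finA \<open>n \<notin> A\<close> cardA by simp
  next
    case False
    then have "0 < n" using \<open>1 \<in> I\<close> by (cases n) auto
    then have "0 \<in> A"
      using anch len by (auto simp: A_def anchored_conv_nth)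
    have "slots I (Suc n) xs = insert n (A - {0})"
      using False \<open>0 < n\<close> by (auto simp: slots_def A_def len)
    moreover have "I \<inter> {1..Suc n} = I \<inter> {1..n}"
      using False by (auto simp: le_Suc_eq)
    ultimately show ?thesis
      using finA \<open>n \<notin> A\<close> cardA card.remove[OF finA \<open>0 \<in> A\<close>] by simp
  qed
qed

text \<open>Deleting the largest entry inverts the insertion, by the equivalence in
  \<open>anchored_insert_at\<close>.\<close>

lemma arrangements_Suc:
  "bij_betw (insert_at (Suc n)) (SIGMA xs:arrangements n I. slots I (Suc n) xs)
     (arrangements (Suc n) I)"
  unfolding bij_betw_def
proof
  let ?D = "SIGMA xs:arrangements n I. slots I (Suc n) xs"
  have "?D \<subseteq> {(xs, p). Suc n \<notin> set xs \<and> p \<le> length xs}"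
    by (auto simp: arrangements_def slots_def)
  then show "inj_on (insert_at (Suc n)) ?D"
    by (rule inj_on_subset[OF inj_on_insert_at])
  have "insert_at (Suc n) (xs, p) \<in> arrangements (Suc n) I"
    if xs: "xs \<in> arrangements n I" and p: "p \<in> slots I (Suc n) xs" for xs p
  proof -
    have set: "set (take p xs) \<union> set (drop p xs) = {1..n}"
      using xs by (simp add: arrangements_def flip: set_append)
    have "Suc n \<notin> set (take p xs) \<union> set (drop p xs)"
      by (simp add: set)
    moreover have "distinct (take p xs @ drop p xs)"
      using xs unfolding append_take_drop_id by (simp add: arrangements_def)
    ultimately have "distinct (insert_at (Suc n) (xs, p))"
      unfolding distinct_append by (auto simp: insert_at_def)
    moreover have "set (insert_at (Suc n) (xs, p)) = insert (Suc n) {1..n}"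
      by (simp add: insert_at_def set)
    then have "set (insert_at (Suc n) (xs, p)) = {1..Suc n}"
      by (simp add: atLeastAtMostSuc_conv)
    moreover have "anchored I (insert_at (Suc n) (xs, p))"
      using xs p anchored_insert_at[of xs "Suc n" p I]
      by (auto simp: arrangements_def slots_def)
    ultimately show ?thesis by (simp add: arrangements_def)
  qed
  moreover have "zs \<in> insert_at (Suc n) ` ?D" if zs: "zs \<in> arrangements (Suc n) I" for zs
  proof -
    have "Suc n \<in> set zs" using zs by (auto simp: arrangements_def)
    then obtain us vs where split: "zs = us @ Suc n # vs"
      by (meson split_list)
    define xs p where "xs = us @ vs" and "p = length us"
    have ins: "zs = insert_at (Suc n) (xs, p)"
      by (simp add: split insert_at_def xs_def p_def)
    have *: "Suc n \<notin> set xs" "distinct xs" "insert (Suc n) (set xs) = {1..Suc n}"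
      using zs by (auto simp: arrangements_def split xs_def)
    have "set xs = insert (Suc n) (set xs) - {Suc n}"
      using *(1) by blast
    also have "\<dots> = {1..n}" unfolding *(3) by auto
    finally have set: "set xs = {1..n}" .
    moreover have "p \<le> length xs" by (simp add: xs_def p_def)
    moreover have "anchored I (insert_at (Suc n) (xs, p))"
      using zs unfolding ins arrangements_def by blast
    ultimately have "anchored I xs \<and> p \<in> slots I (Suc n) xs"
      using anchored_insert_at[of xs "Suc n" p I] by auto
    then have "(xs, p) \<in> ?D"
      using * set by (simp add: arrangements_def)
    then show ?thesis using ins by blast
  qed
  ultimately show "insert_at (Suc n) ` ?D = arrangements (Suc n) I"
    by auto
qed

lemma card_arrangements:
  assumes "1 \<in> I"
  shows "card (arrangements n I) = (\<Prod>j=1..n. card (I \<inter> {1..j}))"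
proof (induction n)
  case 0
  have "arrangements 0 I = {[]}"
    by (auto simp: arrangements_def anchored_def)
  then show ?case by simp
next
  case (Suc n)
  have fin: "finite (arrangements n I)"
    by (rule finite_subset[OF _ finite_subset_distinct[of "{1..n}"]])
      (auto simp: arrangements_def)
  have "card (arrangements (Suc n) I) = card (SIGMA xs:arrangements n I. slots I (Suc n) xs)"
    using bij_betw_same_card[OF arrangements_Suc] by metis
  also have "\<dots> = (\<Sum>xs\<in>arrangements n I. card (slots I (Suc n) xs))"
    by (rule card_SigmaI) (auto simp: fin slots_def)
  also have "\<dots> = card (arrangements n I) * card (I \<inter> {1..Suc n})"
    using card_slots[OF _ assms] by simp
  finally show ?case
    by (simp add: Suc.IH mult.commute)
qed

section \<open>Outcomes as arrangements\<close>

lemma chosen_spot_lucky: "a \<notin> occ \<Longrightarrow> chosen_spot n occ a = Some a"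
  by (simp add: chosen_spot_def)

lemma chosen_spot_next:
  assumes "a \<in> occ" "Suc a \<notin> occ" "Suc a \<le> n"
  shows "chosen_spot n occ a = Some (Suc a)"
proof -
  have "(LEAST s. a < s \<and> s \<notin> occ) = Suc a"
    using assms by (intro Least_equality) auto
  moreover have "Suc a \<in> {a<..n}"
    using assms by simp
  ultimately show ?thesis
    using assms(1,2) unfolding chosen_spot_def by (simp only: if_False not_not bexI if_True not_True_eq_False)
qed

lemma chosen_spot_free:
  assumes "chosen_spot n occ a = Some s" and "a \<le> n"
  shows "a \<le> s" "s \<le> n" "s \<notin> occ"
proof -
  have "a \<le> s \<and> s \<le> n \<and> s \<notin> occ"
  proof (cases "a \<in> occ")
    case False
    then show ?thesis using assms by (auto simp: chosen_spot_def)
  next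
    case True
    then obtain t where t: "a < t" "t \<le> n" "t \<notin> occ"
      using assms by (auto simp: chosen_spot_def split: if_splits)
    have s: "s = (LEAST s. a < s \<and> s \<notin> occ)"
      using assms True by (auto simp: chosen_spot_def split: if_splits)
    have "a < s \<and> s \<notin> occ"
      using LeastI[of "\<lambda>s. a < s \<and> s \<notin> occ" t] t unfolding s by blast
    moreover have "s \<le> t"
      using Least_le[of "\<lambda>s. a < s \<and> s \<notin> occ" t] t unfolding s by blast
    ultimately show ?thesis using t by auto
  qed
  then show "a \<le> s" "s \<le> n" "s \<notin> occ" by auto
qed

text \<open>A displaced car takes the first free spot behind its preferred one, so the spot just before
  it is occupied; this may be the preferred spot itself.\<close>

lemma chosen_spot_unlucky:
  assumes "chosen_spot n occ a = Some s" and "s \<noteq> a"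
  shows "a < s" "s - 1 \<in> occ"
proof -
  have occ: "a \<in> occ" and ex: "\<exists>t. a < t \<and> t \<notin> occ"
    and s: "s = (LEAST s. a < s \<and> s \<notin> occ)"
    using assms by (auto simp: chosen_spot_def split: if_splits)
  show "a < s" unfolding s using LeastI_ex[OF ex] by simp
  moreover have "\<not> (a < s - 1 \<and> s - 1 \<notin> occ)"
    using \<open>a < s\<close> not_less_Least[of "s - 1" "\<lambda>s. a < s \<and> s \<notin> occ"] s by auto
  ultimately show "s - 1 \<in> occ"
    using occ by (cases "s - 1 = a") auto
qed

text \<open>Injectivity of \<open>pos\<close> says that no car is overwritten by a later one.\<close>

lemma street_eq_Some_iff:
  assumes spot: "\<And>j. j \<in> {1..m} \<Longrightarrow> parking_spot \<alpha> j = Some (pos j)"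
    and inj: "inj_on pos {1..m}"
  shows "street \<alpha> m s = Some j \<longleftrightarrow> j \<in> {1..m} \<and> pos j = s"
  using assms
proof (induction m)
  case 0
  then show ?case by simp
next
  case (Suc m)
  have IH: "street \<alpha> m s = Some j \<longleftrightarrow> j \<in> {1..m} \<and> pos j = s"
    using Suc.prems by (intro Suc.IH) (auto simp: inj_on_def)
  have "chosen_spot (length \<alpha>) (dom (street \<alpha> m)) (\<alpha> ! m) = Some (pos (Suc m))"
    using Suc.prems(1)[of "Suc m"] by (simp add: parking_spot_def)
  then have "street \<alpha> (Suc m) = (street \<alpha> m)(pos (Suc m) \<mapsto> Suc m)"
    by simp
  then show ?case
    using IH inj_onD[OF Suc.prems(2), of j "Suc m"] by (auto simp: le_Suc_eq)
qed

lemma dom_street: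
  assumes "\<And>j. j \<in> {1..m} \<Longrightarrow> parking_spot \<alpha> j = Some (pos j)"
    and "inj_on pos {1..m}"
  shows "dom (street \<alpha> m) = pos ` {1..m}"
  using street_eq_Some_iff[OF assms] by (auto simp: dom_def image_iff)

lemma nth_outcome:
  assumes spot: "\<And>j. j \<in> {1..length \<alpha>} \<Longrightarrow> parking_spot \<alpha> j = Some (pos j)"
    and inj: "inj_on pos {1..length \<alpha>}"
    and j: "j \<in> {1..length \<alpha>}" "pos j \<in> {1..length \<alpha>}"
  shows "outcome \<alpha> ! (pos j - 1) = j"
proof -
  have "street \<alpha> (length \<alpha>) (pos j) = Some j"
    using street_eq_Some_iff[OF spot inj] j by blast
  moreover have "pos j - 1 < length [1..<Suc (length \<alpha>)]"
    and "[1..<Suc (length \<alpha>)] ! (pos j - 1) = pos j"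
    using j(2) by (auto simp: nth_upt simp del: upt_Suc)
  ultimately show ?thesis
    unfolding outcome_def by (simp only: nth_map option.sel)
qed

text \<open>Each car takes a spot in \<open>{1..n}\<close> that the earlier cars left free. So the spots are distinct,
  and they fill the street because there are as many cars as spots.\<close>

lemma PF_spots:
  assumes "\<alpha> \<in> PF n"
  shows "\<exists>pos. (\<forall>j\<in>{1..n}. parking_spot \<alpha> j = Some (pos j)) \<and> bij_betw pos {1..n} {1..n}"
proof -
  define pos where "pos j = the (parking_spot \<alpha> j)" for j
  have len: "length \<alpha> = n" and pref: "set \<alpha> \<subseteq> {1..n}"
    using assms by (auto simp: PF_def)
  have spot: "parking_spot \<alpha> j = Some (pos j)" if "j \<in> {1..n}" for j
    using assms that by (auto simp: PF_def pos_def)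
  have range: "pos j \<in> {1..n}" and free: "pos j \<notin> dom (street \<alpha> (j - 1))"
    if "j \<in> {1..n}" for j
  proof -
    have "\<alpha> ! (j - 1) \<in> set \<alpha>"
      using that len by (intro nth_mem) auto
    then have a: "\<alpha> ! (j - 1) \<in> {1..n}" using pref by blast
    have "chosen_spot n (dom (street \<alpha> (j - 1))) (\<alpha> ! (j - 1)) = Some (pos j)"
      using spot[OF that] by (simp add: parking_spot_def len)
    from chosen_spot_free[OF this] a
    show "pos j \<in> {1..n}" "pos j \<notin> dom (street \<alpha> (j - 1))"
      by auto
  qed
  have "inj_on pos {1..m}" if "m \<le> n" for m
    using that
  proof (induction m)
    case (Suc m)
    have inj: "inj_on pos {1..m}" using Suc by simp
    moreover have "dom (street \<alpha> m) = pos ` {1..m}"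
      using Suc.prems spot by (intro dom_street inj) auto
    then have "pos (Suc m) \<notin> pos ` {1..m}"
      using free[of "Suc m"] Suc.prems by simp
    ultimately show ?case
      by (auto simp: atLeastAtMostSuc_conv)
  qed simp
  then have "inj_on pos {1..n}" by blast
  moreover have "pos ` {1..n} \<subseteq> {1..n}" using range by blast
  ultimately have "bij_betw pos {1..n} {1..n}"
    by (simp add: bij_betw_def endo_inj_surj)
  with spot show ?thesis by blast
qed

text \<open>The left neighbour of an unlucky car parked earlier, which means that its number is
  smaller.\<close>

lemma outcome_in_arrangements:
  assumes "\<alpha> \<in> PF n"
  shows "outcome \<alpha> \<in> arrangements n (Lucky \<alpha>)"
proof -
  obtain pos where spot: "\<And>j. j \<in> {1..n} \<Longrightarrow> parking_spot \<alpha> j = Some (pos j)"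
    and bij: "bij_betw pos {1..n} {1..n}"
    using PF_spots[OF assms] by blast
  have len: "length \<alpha> = n" and pref: "set \<alpha> \<subseteq> {1..n}"
    using assms by (auto simp: PF_def)
  have inj: "inj_on pos {1..n}" and img: "pos ` {1..n} = {1..n}"
    using bij by (auto simp: bij_betw_def)
  have nth: "outcome \<alpha> ! (pos j - 1) = j" if "j \<in> {1..n}" for j
    using that img by (intro nth_outcome) (simp_all only: len spot inj, blast)
  have length: "length (outcome \<alpha>) = n"
    by (simp add: outcome_def len)
  have "{1..n} \<subseteq> set (outcome \<alpha>)"
  proof
    fix j assume j: "j \<in> {1..n}"
    then have "pos j \<in> {1..n}" using img by blast
    then have "pos j - 1 < length (outcome \<alpha>)" by (auto simp: length)
    then show "j \<in> set (outcome \<alpha>)" using nth[OF j] nth_mem by metis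
  qed
  then have set: "set (outcome \<alpha>) = {1..n}"
    using card_length[of "outcome \<alpha>"] length
    by (intro card_seteq[symmetric]) auto
  then have dist: "distinct (outcome \<alpha>)"
    by (intro card_distinct) (simp add: length)
  have "anchored (Lucky \<alpha>) (outcome \<alpha>)"
    unfolding anchored_conv_nth length
  proof (intro allI impI)
    fix p assume "p < n"
    then have "Suc p \<in> pos ` {1..n}" unfolding img by simp
    then obtain j where j: "j \<in> {1..n}" "pos j = Suc p" by auto
    have out: "outcome \<alpha> ! p = j" using nth[OF j(1)] j(2) by simp
    show "outcome \<alpha> ! p \<in> Lucky \<alpha> \<or>
      0 < p \<and> 0 < outcome \<alpha> ! (p - 1) \<and> outcome \<alpha> ! (p - 1) < outcome \<alpha> ! p"
    proof (cases "j \<in> Lucky \<alpha>")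
      case False
      then have ne: "Suc p \<noteq> \<alpha> ! (j - 1)"
        using j spot by (auto simp: Lucky_def len)
      have "\<alpha> ! (j - 1) \<in> set \<alpha>"
        using j len by (intro nth_mem) auto
      then have a: "1 \<le> \<alpha> ! (j - 1)" using pref by auto
      have ch: "chosen_spot n (dom (street \<alpha> (j - 1))) (\<alpha> ! (j - 1)) = Some (Suc p)"
        using spot[OF j(1)] j(2) by (simp add: parking_spot_def len)
      have "\<alpha> ! (j - 1) < Suc p" and occ: "p \<in> dom (street \<alpha> (j - 1))"
        using chosen_spot_unlucky[OF ch ne] by simp_all
      then have "0 < p" using a by simp
      have "dom (street \<alpha> (j - 1)) = pos ` {1..j - 1}"
        using j(1) spot by (intro dom_street inj_on_subset[OF inj]) auto
      then obtain j' where j': "j' \<in> {1..j - 1}" "p = pos j'" using occ by auto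
      then have "outcome \<alpha> ! (p - 1) = j'"
        using nth[of j'] j(1) by auto
      then show ?thesis using j' out \<open>0 < p\<close> by auto
    qed (simp add: out)
  qed
  then show ?thesis
    using set dist by (simp add: arrangements_def)
qed

text \<open>
  Let each car of \<open>I\<close> prefer the spot where it stands in \<open>xs\<close>, and each other car the spot before
  that one. When a car outside \<open>I\<close> arrives, its left neighbour in \<open>xs\<close> has a smaller number and
  so already occupies the preferred spot, while the next spot is still free.
\<close>

lemma arrangement_is_outcome:
  assumes "xs \<in> arrangements n I" and "I \<subseteq> {1..n}"
  obtains \<alpha> where "\<alpha> \<in> PF n" "Lucky \<alpha> = I" "outcome \<alpha> = xs"
proof -
  have len: "length xs = n" and dist: "distinct xs" and set: "set xs = {1..n}"
    and anch: "anchored I xs"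
    using assms(1) length_arrangement by (auto simp: arrangements_def)
  \<comment> \<open>\<open>pos j\<close> is the spot of car \<open>j\<close>; spots are counted from 1, list positions from 0.\<close>
  define pos where "pos = the_inv_into {1..n} (\<lambda>s. xs ! (s - 1))"
  have "bij_betw ((!) xs) {..<n} {1..n}"
    using bij_betw_nth[OF dist] len set by simp
  moreover have "bij_betw (\<lambda>s. s - 1) {1..n} {..<n}"
    by (rule bij_betw_byWitness[where f' = Suc]) auto
  ultimately have "bij_betw ((!) xs \<circ> (\<lambda>s. s - 1)) {1..n} {1..n}"
    by (rule bij_betw_trans[rotated])
  then have bijx: "bij_betw (\<lambda>s. xs ! (s - 1)) {1..n} {1..n}"
    by (simp add: comp_def)
  then have bij: "bij_betw pos {1..n} {1..n}"
    unfolding pos_def by (rule bij_betw_the_inv_into)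
  have pos: "pos j \<in> {1..n}" "xs ! (pos j - 1) = j" if "j \<in> {1..n}" for j
    using bij that f_the_inv_into_f_bij_betw[OF bijx] unfolding pos_def
    by (auto dest: bij_betwE)
  have inj: "inj_on pos {1..n}" using bij by (rule bij_betw_imp_inj_on)
  have pos_nth: "pos (xs ! (s - 1)) = s" if "s \<in> {1..n}" for s
    using the_inv_into_f_f[of "\<lambda>s. xs ! (s - 1)" "{1..n}"] bijx that
    unfolding pos_def bij_betw_def by blast
  have left: "1 < pos j" "\<exists>j'\<in>{1..<j}. pos j' = pos j - 1" if "j \<in> {1..n} - I" for j
  proof -
    have j: "j \<in> {1..n}" "j \<notin> I" using that by auto
    note p = pos[OF j(1)]
    have *: "0 < pos j - 1" "0 < xs ! (pos j - 1 - 1)" "xs ! (pos j - 1 - 1) < j"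
      using anch[unfolded anchored_conv_nth, rule_format, of "pos j - 1"] p j len by auto
    then show "1 < pos j" by simp
    show "\<exists>j'\<in>{1..<j}. pos j' = pos j - 1"
    proof (rule bexI)
      have "pos j - 1 \<in> {1..n}" using * p(1) by auto
      then show "pos (xs ! (pos j - 1 - 1)) = pos j - 1" by (rule pos_nth)
      show "xs ! (pos j - 1 - 1) \<in> {1..<j}" using * by simp
    qed
  qed
  define \<alpha> where "\<alpha> = map (\<lambda>j. if j \<in> I then pos j else pos j - 1) [1..<Suc n]"
  have lena: "length \<alpha> = n" by (simp add: \<alpha>_def)
  have ntha: "\<alpha> ! (j - 1) = (if j \<in> I then pos j else pos j - 1)" if "j \<in> {1..n}" for j
    using that by (auto simp: \<alpha>_def simp del: upt_Suc)
  have spot: "parking_spot \<alpha> j = Some (pos j)" if "j \<in> {1..n}" for j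
    using that
  proof (induction j rule: less_induct)
    case (less j)
    have dom: "dom (street \<alpha> (j - 1)) = pos ` {1..j - 1}"
      using less by (intro dom_street inj_on_subset[OF inj]) auto
    then have park: "parking_spot \<alpha> j = chosen_spot n (pos ` {1..j - 1}) (\<alpha> ! (j - 1))"
      by (simp only: parking_spot_def lena)
    have free: "pos j \<notin> pos ` {1..j - 1}"
      using less.prems inj_onD[OF inj, of j] by fastforce
    show ?case
    proof (cases "j \<in> I")
      case True
      then show ?thesis
        using free ntha[OF less.prems] by (simp add: park chosen_spot_lucky)
    next
      case False
      obtain j' where "j' \<in> {1..<j}" "pos j' = pos j - 1"
        using left(2)[of j] less.prems False by blast
      then have "pos j - 1 \<in> pos ` {1..j - 1}"
        by (intro image_eqI[of _ _ j']) auto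
      then show ?thesis
        using False free ntha[OF less.prems] left(1)[of j] less.prems pos(1)[OF less.prems]
          chosen_spot_next[of "pos j - 1" "pos ` {1..j - 1}" n]
        by (simp add: park)
    qed
  qed
  have "set \<alpha> \<subseteq> {1..n}"
  proof
    fix a assume "a \<in> set \<alpha>"
    then have "a \<in> (\<lambda>j. if j \<in> I then pos j else pos j - 1) ` {1..n}"
      unfolding \<alpha>_def set_map set_upt atLeastLessThanSuc_atLeastAtMost .
    then obtain j where "j \<in> {1..n}" "a = (if j \<in> I then pos j else pos j - 1)"
      by blast
    then show "a \<in> {1..n}"
      using pos(1)[of j] left(1)[of j] by (auto split: if_splits)
  qed
  then have "\<alpha> \<in> PF n" using spot lena by (simp add: PF_def)
  moreover have "parking_spot \<alpha> j = Some (\<alpha> ! (j - 1)) \<longleftrightarrow> j \<in> I" if "j \<in> {1..n}" for j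
    using spot[OF that] ntha[OF that] left(1)[of j] that by (cases "j \<in> I") auto
  then have "Lucky \<alpha> = I"
    using assms(2) unfolding Lucky_def lena by blast
  moreover have "outcome \<alpha> = xs"
  proof (rule nth_equalityI)
    show "length (outcome \<alpha>) = length xs" by (simp add: outcome_def lena len del: upt_Suc)
    fix p assume "p < length (outcome \<alpha>)"
    then have "Suc p \<in> {1..n}" by (simp add: outcome_def lena del: upt_Suc)
    moreover from this have "xs ! p \<in> {1..n}"
      using set len nth_mem[of p xs] by auto
    ultimately show "outcome \<alpha> ! p = xs ! p"
      using nth_outcome[of \<alpha> pos "xs ! p"] spot inj lena pos_nth[of "Suc p"] by simp
  qed
  ultimately show ?thesis by (rule that)
qed

lemma outcomes_eq_arrangements:
  assumes "I \<subseteq> {1..n}"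
  shows "outcomes n I = arrangements n I"
proof
  show "outcomes n I \<subseteq> arrangements n I"
    using outcome_in_arrangements by (auto simp: outcomes_def)
  show "arrangements n I \<subseteq> outcomes n I"
  proof
    fix xs assume "xs \<in> arrangements n I"
    then obtain \<alpha> where "\<alpha> \<in> PF n" "Lucky \<alpha> = I" "outcome \<alpha> = xs"
      using assms by (rule arrangement_is_outcome)
    then show "xs \<in> outcomes n I"
      by (auto simp: outcomes_def)
  qed
qed

section \<open>Evaluating the product\<close>

lemma card_enumerated_upto:
  fixes i :: "nat \<Rightarrow> nat"
  assumes mono: "strict_mono_on {..<k} i" and pos: "1 \<le> i 0"
    and l: "l < k" "i l \<le> j" "Suc l < k \<Longrightarrow> j < i (Suc l)"
  shows "card (i ` {..<k} \<inter> {1..j}) = Suc l"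
proof -
  have le: "i a \<le> i b" if "a \<le> b" "b < k" for a b
    using strict_mono_on_leD[OF mono] that by auto
  have "i ` {..<k} \<inter> {1..j} = i ` {..l}"
  proof (intro equalityI subsetI)
    fix x assume "x \<in> i ` {..<k} \<inter> {1..j}"
    then obtain a where a: "a < k" "x = i a" "i a \<le> j" by auto
    have "a \<le> l"
    proof (rule ccontr)
      assume "\<not> a \<le> l"
      then have "Suc l \<le> a" by simp
      then show False using le[of "Suc l" a] l(3) a by simp
    qed
    then show "x \<in> i ` {..l}" using a by simp
  next
    fix x assume "x \<in> i ` {..l}"
    then obtain a where "a \<le> l" "x = i a" by auto
    then show "x \<in> i ` {..<k} \<inter> {1..j}"
      using le[of a l] le[of 0 a] l pos by auto
  qed
  moreover have "inj_on i {..l}"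
    using strict_mono_on_imp_inj_on[OF mono] l(1) by (auto intro: inj_on_subset)
  ultimately show ?thesis by (simp add: card_image)
qed

theorem theorem2p2:
  fixes n k :: nat and i :: "nat \<Rightarrow> nat" and I :: "nat set"
  assumes "n \<ge> 1" and "k \<ge> 1"
    and "i 0 = 1" and "strict_mono_on {..<k} i" and "i (k - 1) \<le> n"
    and "I = i ` {..<k}"
    and "lucky_set n I"
  shows "card (outcomes n I) = fact k * (\<Prod>j\<in>{1..n} - I. card (I \<inter> {1..j})) \<and>
         fact k * (\<Prod>j\<in>{1..n} - I. card (I \<inter> {1..j})) =
           (\<Prod>l=2..k-1. l ^ (i l - i (l - 1))) * k ^ (n - (i (k - 1) - 1))"
proof -
  define c where "c j = card (I \<inter> {1..j})" for j
  have sub: "I \<subseteq> {1..n}" using assms(7) by (simp add: lucky_set_def)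
  have "1 \<in> I" using assms(2,3,6) by force
  have c: "c j = Suc l" if "l < k" "i l \<le> j" "Suc l < k \<Longrightarrow> j < i (Suc l)" for j l
    unfolding c_def assms(6) using card_enumerated_upto[OF assms(4) _ that] assms(3) by simp
  have less: "i a < i b" if "a < b" "b < k" for a b
    using strict_mono_onD[OF assms(4)] that by auto
  have le: "i a \<le> i b" if "a \<le> b" "b < k" for a b
    using less[of a b] that by (cases "a = b") auto

  have "(\<Prod>j\<in>I. c j) = (\<Prod>l<k. c (i l))"
    unfolding assms(6) using strict_mono_on_imp_inj_on[OF assms(4)] by (simp add: prod.reindex)
  also have "\<dots> = (\<Prod>l<k. Suc l)"
    using c less by (intro prod.cong) auto
  also have "\<dots> = fact k"
    by (simp add: fact_prod_Suc lessThan_atLeast0)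
  finally have anchors: "(\<Prod>j\<in>I. c j) = fact k" .
  have split: "(\<Prod>j=1..n. c j) = fact k * (\<Prod>j\<in>{1..n} - I. c j)"
    using prod.subset_diff[OF sub, of c] anchors by (simp add: mult.commute)

  \<comment> \<open>On the block from \<open>i m\<close> up to but excluding \<open>i (Suc m)\<close> the factor is constantly \<open>Suc m\<close>.\<close>
  have partial: "(\<Prod>j=1..<i m. c j) = (\<Prod>l=1..m. l ^ (i l - i (l - 1)))" if "m < k" for m
    using that
  proof (induction m)
    case 0
    then show ?case by (simp add: assms(3))
  next
    case (Suc m)
    have "1 \<le> i m" using le[of 0 m] Suc.prems assms(3) by simp
    moreover have "i m \<le> i (Suc m)" using le Suc.prems by simp
    ultimately have "(\<Prod>j=1..<i (Suc m). c j) = (\<Prod>j=1..<i m. c j) * (\<Prod>j=i m..<i (Suc m). c j)"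
      by (simp add: prod.atLeastLessThan_concat)
    also have "(\<Prod>j=i m..<i (Suc m). c j) = (\<Prod>j=i m..<i (Suc m). Suc m)"
      using Suc.prems by (intro prod.cong c) auto
    finally show ?case using Suc by simp
  qed
  have "1 \<le> i (k - 1)" using le[of 0 "k - 1"] assms(2,3) by simp
  then have "(\<Prod>j=1..n. c j) = (\<Prod>j=1..<i (k - 1). c j) * (\<Prod>j=i (k - 1)..<Suc n. c j)"
    using assms(5) by (simp add: prod.atLeastLessThan_concat atLeastLessThanSuc_atLeastAtMost
        flip: atLeastLessThanSuc_atLeastAtMost)
  also have "(\<Prod>j=i (k - 1)..<Suc n. c j) = (\<Prod>j=i (k - 1)..<Suc n. k)"
    using assms(2) c[of "k - 1"] by (intro prod.cong) auto
  also have "\<dots> = k ^ (n - (i (k - 1) - 1))"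
    using \<open>1 \<le> i (k - 1)\<close> by (simp add: Suc_diff_le)
  also have "(\<Prod>j=1..<i (k - 1). c j) = (\<Prod>l=1..k-1. l ^ (i l - i (l - 1)))"
    using partial assms(2) by simp
  \<comment> \<open>The factor for \<open>l = 1\<close> is a power of 1.\<close>
  also have "\<dots> = (\<Prod>l=2..k-1. l ^ (i l - i (l - 1)))"
    by (rule prod.mono_neutral_right) (auto simp: not_less_eq_eq)
  finally show ?thesis
    using split outcomes_eq_arrangements[OF sub] card_arrangements[OF \<open>1 \<in> I\<close>, of n]
    by (simp add: c_def)
qed

end
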